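(* Let $G'$ and $H'$ be two non-trivial, connected graphs. Then $$r(G' \Box H') \le rc(G' \Box H') \le 2\,r(G' \Box H').$$
   Context: All graphs are finite, simple and undirected. A graph is trivial if it has order (number of vertices) 0 or 1, and non-trivial otherwise. For a connected graph $G$: $dist_G(u,v)$ is the length (number of edges) of a shortest path between $u$ and $v$; the eccentricity of a vertex $v$ is $ecc(v)=\max\{dist_G(v,u): u\in V(G)\}$; the radius is $r(G)=\min\{ecc(v): v\in V(G)\}$. An edge coloring of $G$ is any function from $E(G)$ to a set of colors (not necessarily proper). A path is a rainbow path if no two of its edges have the same color. An edge coloring is a rainbow coloring if every pair of vertices is connected by at least one rainbow path. The rainbow connection number $rc(G)$ of a connected graph $G$ is the minimum number of colors in a rainbow coloring of $G$. The Cartesian product $G \Box H$ has vertex set $V(G)\times V(H)$; two distinct vertices $[g_1,h_1]$ and $[g_2,h_2]$ are adjacent if and only if either $g_1=g_2$ and $(h_1,h_2)\in E(H)$, or $h_1=h_2$ and $(g_1,g_2)\in E(G)$. *)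

theory Defs
  imports "Graph_Theory.Graph_Theory"
begin

text \<open>
  Finite simple undirected graphs are represented by \<^locale>\<open>pair_graph\<close>: finite, loop-free
  digraphs whose arcs are ordered pairs and form a symmetric relation. An undirected edge is
  thus a pair of opposite arcs. Vertex paths (\<^const>\<open>vpath\<close>) are nonempty lists of distinct
  vertices, so \<^term>\<open>[v]\<close> is the path of length 0 from \<^term>\<open>v\<close> to itself.
\<close>

definition trivial_graph :: "'a pair_pre_digraph \<Rightarrow> bool" where
  "trivial_graph G \<longleftrightarrow> card (pverts G) \<in> {0, 1}"

definition path_betw :: "'a pair_pre_digraph \<Rightarrow> 'a \<Rightarrow> 'a vwalk \<Rightarrow> 'a \<Rightarrow> bool" where
  "path_betw G u p v \<longleftrightarrow> vpath p (with_proj G) \<and> hd p = u \<and> last p = v"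

definition graph_dist :: "'a pair_pre_digraph \<Rightarrow> 'a \<Rightarrow> 'a \<Rightarrow> nat" where
  "graph_dist G u v = (LEAST n. \<exists>p. path_betw G u p v \<and> vwalk_length p = n)"

definition ecc :: "'a pair_pre_digraph \<Rightarrow> 'a \<Rightarrow> nat" where
  "ecc G v = Max ((\<lambda>u. graph_dist G v u) ` pverts G)"

definition radius :: "'a pair_pre_digraph \<Rightarrow> nat" where
  "radius G = Min (ecc G ` pverts G)"

definition edge_of :: "'a \<times> 'a \<Rightarrow> 'a set" where
  "edge_of a = {fst a, snd a}"

definition edges :: "'a pair_pre_digraph \<Rightarrow> 'a set set" where
  "edges G = edge_of ` parcs G"

text \<open>
  An edge colouring is a function on two-element vertex sets, so both orientations of an edge
  have the same colour; only its values on \<^term>\<open>edges G\<close> matter.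
\<close>

definition rainbow_path :: "('a set \<Rightarrow> 'c) \<Rightarrow> 'a vwalk \<Rightarrow> bool" where
  "rainbow_path c p \<longleftrightarrow> distinct (map (\<lambda>a. c (edge_of a)) (vwalk_arcs p))"

definition rainbow_coloring :: "'a pair_pre_digraph \<Rightarrow> ('a set \<Rightarrow> 'c) \<Rightarrow> bool" where
  "rainbow_coloring G c \<longleftrightarrow>
    (\<forall>u\<in>pverts G. \<forall>v\<in>pverts G. \<exists>p. path_betw G u p v \<and> rainbow_path c p)"

text \<open>
  The edge set is finite, so natural numbers suffice as colours. The number of colours of a
  colouring is the number of colours that it actually uses.
\<close>

definition rc :: "'a pair_pre_digraph \<Rightarrow> nat" where
  "rc G = (LEAST k. \<exists>c :: 'a set \<Rightarrow> nat. rainbow_coloring G c \<and> card (c ` edges G) = k)"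

definition cart_prod ::
  "'a pair_pre_digraph \<Rightarrow> 'b pair_pre_digraph \<Rightarrow> ('a \<times> 'b) pair_pre_digraph"
  (infixr \<open>\<box>\<close> 70) where
  "G \<box> H =
    \<lparr> pverts = pverts G \<times> pverts H,
      parcs = {((g1, h1), (g2, h2)) | g1 h1 g2 h2.
        (g1 = g2 \<and> g1 \<in> pverts G \<and> (h1, h2) \<in> parcs H) \<or>
        (h1 = h2 \<and> h1 \<in> pverts H \<and> (g1, g2) \<in> parcs G)} \<rparr>"

text \<open>
  Well-definedness: products of graphs are graphs, products of connected graphs are connected,
  and connected graphs have paths between all vertices and a rainbow colouring (so the \<open>LEAST\<close>
  operators above range over nonempty sets).
\<close>

lemma pair_graph_cart_prod:
  assumes "pair_graph G" "pair_graph H"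
  shows "pair_graph (G \<box> H)"
proof -
  interpret G: pair_graph G by fact
  interpret H: pair_graph H by fact
  have sub: "parcs (G \<box> H) \<subseteq> (pverts G \<times> pverts H) \<times> (pverts G \<times> pverts H)"
    by (auto simp: cart_prod_def dest: G.in_arcsD1 G.in_arcsD2 H.in_arcsD1 H.in_arcsD2)
  have fin: "finite (pverts G \<times> pverts H)"
    using G.pair_finite_verts H.pair_finite_verts by simp
  have symG: "sym (parcs G)" using G.pair_sym_arcs by (simp add: symmetric_def)
  have symH: "sym (parcs H)" using H.pair_sym_arcs by (simp add: symmetric_def)
  show ?thesis
  proof
    show "finite (pverts (G \<box> H))" using fin by (simp add: cart_prod_def)
    show "finite (parcs (G \<box> H))"
      by (rule finite_subset[OF sub]) (intro finite_cartesian_product fin)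
    show "symmetric (with_proj (G \<box> H))"
      using symG[THEN symD] symH[THEN symD]
      unfolding symmetric_def with_proj_simps by (intro symI) (auto simp: cart_prod_def)
  next
    fix e assume e: "e \<in> parcs (G \<box> H)"
    show "fst e \<in> pverts (G \<box> H)" "snd e \<in> pverts (G \<box> H)"
      using subsetD[OF sub e] by (auto simp: mem_Times_iff cart_prod_def)
    show "fst e \<noteq> snd e"
      using e G.pair_no_loops[of "(x, x)" for x] H.pair_no_loops[of "(x, x)" for x]
      by (auto simp: cart_prod_def)
  qed
qed

lemma path_betw_iff_reachable:
  assumes "pair_graph G"
  shows "(\<exists>p. path_betw G u p v) \<longleftrightarrow> reachable (with_proj G) u v"
proof -
  interpret G: pair_graph G by fact
  show ?thesis
    unfolding path_betw_def G.reachable_vpath_conv by blast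
qed

lemma path_betw_iff_rtrancl:
  assumes "pair_graph G"
  shows "(\<exists>p. path_betw G u p v) \<longleftrightarrow> u \<in> pverts G \<and> (u, v) \<in> (parcs G)\<^sup>*"
proof -
  interpret G: pair_graph G by fact
  show ?thesis unfolding path_betw_iff_reachable[OF assms]
    by (metis G.reachable_conv' G.reachable_in_verts(1) with_proj_simps(1,3))
qed

lemma connected_iff_path_betw:
  assumes "pair_graph G"
  shows "connected (with_proj G) \<longleftrightarrow>
    pverts G \<noteq> {} \<and> (\<forall>u\<in>pverts G. \<forall>v\<in>pverts G. \<exists>p. path_betw G u p v)"
proof -
  interpret G: pair_graph G by fact
  have "sym (parcs G)" using G.pair_sym_arcs by (simp add: symmetric_def)
  moreover have "parcs (mk_symmetric (with_proj G)) = parcs G \<union> (parcs G)\<inverse>"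
    by (auto simp: mk_symmetric_def)
  ultimately have "parcs (mk_symmetric (with_proj G)) = parcs G"
    by (simp add: sym_conv_converse_eq)
  then have "mk_symmetric (with_proj G) = G" by (simp add: mk_symmetric_def)
  then have "connected (with_proj G) \<longleftrightarrow> strongly_connected (with_proj G)"
    by (simp add: connected_def)
  then show ?thesis by (simp add: strongly_connected_def path_betw_iff_reachable[OF assms])
qed

lemma connected_cart_prod:
  assumes "pair_graph G" "pair_graph H" "connected (with_proj G)" "connected (with_proj H)"
  shows "connected (with_proj (G \<box> H))"
proof -
  interpret G: pair_graph G by fact
  interpret H: pair_graph H by fact
  interpret P: pair_graph "G \<box> H" using assms by (intro pair_graph_cart_prod)
  have 1: "((g, h), (g', h)) \<in> (parcs (G \<box> H))\<^sup>*"
    if "(g, g') \<in> (parcs G)\<^sup>*" "h \<in> pverts H" for g g' h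
    using that(1)
  proof induct
    case (step y z)
    then have "((y, h), (z, h)) \<in> parcs (G \<box> H)" using that(2) by (simp add: cart_prod_def)
    then show ?case by (rule rtrancl_into_rtrancl[OF step(3)])
  qed simp
  have 2: "((g, h), (g, h')) \<in> (parcs (G \<box> H))\<^sup>*"
    if "(h, h') \<in> (parcs H)\<^sup>*" "g \<in> pverts G" for g h h'
    using that(1)
  proof induct
    case (step y z)
    then have "((g, y), (g, z)) \<in> parcs (G \<box> H)" using that(2) by (simp add: cart_prod_def)
    then show ?case by (rule rtrancl_into_rtrancl[OF step(3)])
  qed simp
  have "(u, v) \<in> (parcs (G \<box> H))\<^sup>*"
    if uv: "u \<in> pverts G \<times> pverts H" "v \<in> pverts G \<times> pverts H" for u v
  proof -
    obtain g h g' h' where [simp]: "u = (g, h)" "v = (g', h')" by fastforce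
    have "(g, g') \<in> (parcs G)\<^sup>*" "(h, h') \<in> (parcs H)\<^sup>*"
      using assms uv by (auto simp: connected_iff_path_betw path_betw_iff_rtrancl)
    then show ?thesis using rtrancl_trans[OF 1[of g g' h] 2[of h h' g']] uv by simp
  qed
  moreover have "pverts (G \<box> H) = pverts G \<times> pverts H" by (simp add: cart_prod_def)
  moreover have "pverts G \<noteq> {}" "pverts H \<noteq> {}"
    using assms by (auto simp: connected_iff_path_betw)
  ultimately show ?thesis
    by (simp add: connected_iff_path_betw[OF P.pair_graph] path_betw_iff_rtrancl[OF P.pair_graph])
qed

lemma rainbow_coloring_exists:
  assumes "pair_graph G" "connected (with_proj G)"
  shows "\<exists>c :: 'a set \<Rightarrow> nat. rainbow_coloring G c"
proof -
  interpret G: pair_graph G by fact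
  have "finite (edges G)" using G.pair_finite_arcs by (simp add: edges_def)
  then obtain c :: "'a set \<Rightarrow> nat" where c: "inj_on c (edges G)"
    using finite_imp_inj_to_nat_seg by metis
  have dist: "distinct (map edge_of (vwalk_arcs p))" if "distinct p" for p :: "'a list"
  proof -
    have sub: "\<Union> (edge_of ` set (vwalk_arcs q)) \<subseteq> set q" for q :: "'a list"
      by (induct q rule: vwalk_arcs.induct) (auto simp: edge_of_def)
    show ?thesis using that
    proof (induct p rule: vwalk_arcs.induct)
      case (3 x y xs)
      have "x \<in> edge_of (x, y)" by (simp add: edge_of_def)
      moreover have "x \<notin> \<Union> (edge_of ` set (vwalk_arcs (y # xs)))"
        using 3(2) sub[of "y # xs"] by auto
      ultimately have "edge_of (x, y) \<notin> edge_of ` set (vwalk_arcs (y # xs))" by blast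
      then show ?case using 3 by simp
    qed auto
  qed
  have "rainbow_path c p" if "path_betw G u p v" for u p v
  proof -
    have "set (vwalk_arcs p) \<subseteq> parcs G" "distinct p"
      using that by (auto simp: path_betw_def vpath_def vwalk_def)
    then have "distinct (map c (map edge_of (vwalk_arcs p)))"
      using dist[of p] c unfolding distinct_map edges_def by (auto intro: inj_on_subset)
    then show ?thesis by (simp add: rainbow_path_def comp_def)
  qed
  then show ?thesis
    using assms(2) unfolding rainbow_coloring_def connected_iff_path_betw[OF assms(1)] by blast
qed

end

theory Submission
  imports Defs
begin

text \<open>
  The lower bound holds because a rainbow path is no longer than the number of colours.

  For the upper bound, let \<open>(g0, h0)\<close> be a centre of \<open>G \<box> H\<close>, and let \<open>R\<close> and \<open>S\<close> be the
  eccentricities of \<open>g0\<close> in \<open>G\<close> and of \<open>h0\<close> in \<open>H\<close>. Distances in the product are at least the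
  sums of the distances in the factors, so \<open>R + S\<close> is at most the radius. Colour an edge by the
  distance of its farther end from \<open>g0\<close> (or from \<open>h0\<close>), with four disjoint palettes: \<open>A\<close> for
  \<open>G\<close>-edges off the layer \<open>h0\<close>, \<open>A'\<close> for \<open>G\<close>-edges in the layer \<open>h0\<close>, \<open>B\<close> for \<open>H\<close>-edges in the
  layer \<open>g0\<close>, and \<open>B'\<close> for \<open>H\<close>-edges off the layer \<open>g0\<close>. A geodesic towards the root within one
  layer is rainbow, and generic vertices \<open>(g, h)\<close> and \<open>(g', h')\<close> are joined through
  \<open>(g0, h)\<close>, \<open>(g0, h0)\<close>, \<open>(g', h0)\<close>, which uses the palettes \<open>A, B, A', B'\<close> once each. Two
  vertices of the layer \<open>h0\<close> are joined by a detour through another layer \<open>y\<close>, with palettes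
  \<open>A', B, A, B'\<close>; similarly for two vertices of the layer \<open>g0\<close>. This is where non-triviality of
  the factors is needed.
\<close>

section \<open>Walks and distances\<close>

lemma path_betw_refl: "u \<in> pverts G \<Longrightarrow> path_betw G u [u] u"
  by (auto simp: path_betw_def vpath_def vwalk_def)

text \<open>If \<open>w\<close> already lies on \<open>p\<close>, the path is cut back to
  \<open>w\<close> instead of extended. In both cases the arcs of \<open>q\<close> form a prefix of
  those of \<open>p\<close> followed by \<open>(v, w)\<close>, so length bounds and distinctness of
  colours carry over.\<close>

lemma path_betw_snoc:
  assumes "pair_graph G" "path_betw G u p v" "(v, w) \<in> parcs G"
  obtains q ys where "path_betw G u q w" "vwalk_arcs q @ ys = vwalk_arcs p @ [(v, w)]"
proof -
  interpret G: pair_graph G by fact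
  have p: "set p \<subseteq> pverts G" "set (vwalk_arcs p) \<subseteq> parcs G" "p \<noteq> []" "distinct p"
    "hd p = u" "last p = v"
    using assms(2) by (auto simp: path_betw_def vpath_def vwalk_def)
  show ?thesis
  proof (cases "w \<in> set p")
    case False
    have "vwalk_arcs (p @ [w]) = vwalk_arcs p @ [(v, w)]"
      using p by (simp add: vwalk_arcs_append)
    moreover from this have "path_betw G u (p @ [w]) w"
      using p False assms(3) G.in_arcsD2[OF assms(3)]
      by (auto simp: path_betw_def vpath_def vwalk_def)
    ultimately show ?thesis by (intro that[of "p @ [w]" "[]"]) auto
  next
    case True
    then obtain xs ys where s: "p = xs @ w # ys" by (auto simp: in_set_conv_decomp)
    have pre: "\<exists>zs. vwalk_arcs p = vwalk_arcs (xs @ [w]) @ zs"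
      using vwalk_arcs_append[of "xs @ [w]" ys] by (cases "ys = []") (auto simp: s)
    then have "path_betw G u (xs @ [w]) w"
      using p by (cases xs) (auto simp: path_betw_def vpath_def vwalk_def s)
    with pre show ?thesis by (elim exE) (rule that, auto)
  qed
qed

lemma path_betw_relpow:
  assumes "path_betw G u p v"
  shows "(u, v) \<in> parcs G ^^ vwalk_length p"
proof -
  have "(hd q, last q) \<in> parcs G ^^ length (vwalk_arcs q)"
    if "q \<noteq> []" "set (vwalk_arcs q) \<subseteq> parcs G" for q
    using that
  proof (induct q rule: vwalk_arcs.induct)
    case (3 x y xs)
    then have "(x, y) \<in> parcs G" "(y, last (y # xs)) \<in> parcs G ^^ length (vwalk_arcs (y # xs))"
      by auto
    from relpow_Suc_I2[OF this] show ?case by simp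
  qed auto
  moreover have "p \<noteq> []" "set (vwalk_arcs p) \<subseteq> parcs G" "hd p = u" "last p = v"
    using assms by (auto simp: path_betw_def vpath_def vwalk_def)
  ultimately show ?thesis unfolding vwalk_length_def by blast
qed

lemma graph_dist_le_path:
  assumes "path_betw G u p v"
  shows "graph_dist G u v \<le> vwalk_length p"
  unfolding graph_dist_def using assms by (intro Least_le) blast

text \<open>Walks counted by relation powers shrink to paths by \<open>path_betw_snoc\<close>. With
  \<open>relpow_graph_dist\<close>, distances become least exponents, which avoids lists of vertices
  later.\<close>

lemma graph_dist_le_relpow:
  assumes "pair_graph G" "u \<in> pverts G" "(u, v) \<in> parcs G ^^ n"
  shows "graph_dist G u v \<le> n"
proof -
  have "\<exists>p. path_betw G u p v \<and> length (vwalk_arcs p) \<le> n"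
    using assms(3)
  proof (induct n arbitrary: v)
    case 0
    then show ?case using path_betw_refl[OF assms(2)] by (intro exI[of _ "[u]"]) auto
  next
    case (Suc n)
    from Suc.prems obtain x where x: "(u, x) \<in> parcs G ^^ n" "(x, v) \<in> parcs G" by auto
    from Suc.hyps[OF x(1)] obtain p
      where p: "path_betw G u p x" "length (vwalk_arcs p) \<le> n" by blast
    obtain q ys where q: "path_betw G u q v" "vwalk_arcs q @ ys = vwalk_arcs p @ [(x, v)]"
      by (rule path_betw_snoc[OF assms(1) p(1) x(2)])
    from arg_cong[OF q(2), of length] p(2) have "length (vwalk_arcs q) \<le> Suc n" by simp
    with q(1) show ?case by blast
  qed
  then show ?thesis
    using graph_dist_le_path unfolding vwalk_length_def by (meson order_trans)
qed

lemma relpow_graph_dist: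
  assumes "pair_graph G" "connected (with_proj G)" "u \<in> pverts G" "v \<in> pverts G"
  shows "(u, v) \<in> parcs G ^^ graph_dist G u v"
proof -
  have "\<exists>n p. path_betw G u p v \<and> vwalk_length p = n"
    using assms connected_iff_path_betw by blast
  then have "\<exists>p. path_betw G u p v \<and> vwalk_length p = graph_dist G u v"
    unfolding graph_dist_def by (rule LeastI_ex)
  then show ?thesis by (auto dest: path_betw_relpow)
qed

lemma graph_dist_predecessor:
  assumes G: "pair_graph G" "connected (with_proj G)" "u \<in> pverts G" "v \<in> pverts G"
    and n: "graph_dist G u v = Suc n"
  obtains w where "w \<in> pverts G" "(w, v) \<in> parcs G" "graph_dist G u w = n"
proof -
  interpret G: pair_graph G by fact
  from relpow_graph_dist[OF G] obtain w where w: "(u, w) \<in> parcs G ^^ n" "(w, v) \<in> parcs G"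
    unfolding n by auto
  have "w \<in> pverts G" using G.in_arcsD1[OF w(2)] .
  moreover have "graph_dist G u w \<le> n" by (rule graph_dist_le_relpow[OF G(1,3) w(1)])
  moreover have "graph_dist G u v \<le> Suc (graph_dist G u w)"
    using relpow_graph_dist[OF G(1-3) \<open>w \<in> pverts G\<close>] w(2)
    by (intro graph_dist_le_relpow[OF G(1,3)]) auto
  ultimately show ?thesis using that w(2) n by simp
qed

lemma graph_dist_le_ecc:
  assumes "pair_graph G" "v \<in> pverts G"
  shows "graph_dist G u v \<le> ecc G u"
proof -
  interpret G: pair_graph G by fact
  show ?thesis unfolding ecc_def using G.pair_finite_verts assms(2) by (intro Max_ge) auto
qed

lemma ecc_attained:
  assumes "pair_graph G" "u \<in> pverts G"
  obtains v where "v \<in> pverts G" "ecc G u = graph_dist G u v"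
proof -
  interpret G: pair_graph G by fact
  have "ecc G u \<in> graph_dist G u ` pverts G"
    unfolding ecc_def using G.pair_finite_verts assms(2) by (intro Max_in) auto
  then show ?thesis using that by auto
qed

lemma radius_attained:
  assumes "pair_graph G" "pverts G \<noteq> {}"
  obtains u where "u \<in> pverts G" "radius G = ecc G u"
proof -
  interpret G: pair_graph G by fact
  have "radius G \<in> ecc G ` pverts G"
    unfolding radius_def using G.pair_finite_verts assms(2) by (intro Min_in) auto
  then show ?thesis using that by auto
qed

lemma radius_le_ecc:
  assumes "pair_graph G" "u \<in> pverts G"
  shows "radius G \<le> ecc G u"
proof -
  interpret G: pair_graph G by fact
  show ?thesis unfolding radius_def using G.pair_finite_verts assms(2) by (intro Min_le) auto
qed

section \<open>Distances in Cartesian products\<close>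

text \<open>Each arc of the product moves exactly one coordinate, so a walk projects to walks in the
  factors whose lengths add up.\<close>

lemma relpow_cart_prod:
  assumes "((g, h), (g', h')) \<in> parcs (G \<box> H) ^^ n"
  shows "\<exists>i j. i + j = n \<and> (g, g') \<in> parcs G ^^ i \<and> (h, h') \<in> parcs H ^^ j"
  using assms
proof (induct n arbitrary: g' h')
  case 0
  then show ?case by auto
next
  case (Suc n)
  then obtain x y where xy: "((g, h), (x, y)) \<in> parcs (G \<box> H) ^^ n"
    "((x, y), (g', h')) \<in> parcs (G \<box> H)" by auto
  from Suc.hyps[OF xy(1)] obtain i j
    where ij: "i + j = n" "(g, x) \<in> parcs G ^^ i" "(h, y) \<in> parcs H ^^ j" by blast
  from xy(2) consider "x = g'" "(y, h') \<in> parcs H" | "y = h'" "(x, g') \<in> parcs G"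
    by (auto simp: cart_prod_def)
  then show ?case
  proof cases
    case 1
    with ij show ?thesis by (intro exI[of _ i] exI[of _ "Suc j"]) auto
  next
    case 2
    with ij show ?thesis by (intro exI[of _ "Suc i"] exI[of _ j]) auto
  qed
qed

text \<open>A product geodesic from \<open>(g, h)\<close> to a vertex farthest in both coordinates
  is projected to both factors.\<close>

lemma ecc_cart_prod_ge:
  assumes "pair_graph G" "pair_graph H" "connected (with_proj G)" "connected (with_proj H)"
    and "g \<in> pverts G" "h \<in> pverts H"
  shows "ecc G g + ecc H h \<le> ecc (G \<box> H) (g, h)"
proof -
  have P: "pair_graph (G \<box> H)" "connected (with_proj (G \<box> H))"
    using assms by (auto intro: pair_graph_cart_prod connected_cart_prod)
  obtain g' where g': "g' \<in> pverts G" "ecc G g = graph_dist G g g'"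
    by (rule ecc_attained[OF assms(1,5)])
  obtain h' where h': "h' \<in> pverts H" "ecc H h = graph_dist H h h'"
    by (rule ecc_attained[OF assms(2,6)])
  have v: "(g, h) \<in> pverts (G \<box> H)" "(g', h') \<in> pverts (G \<box> H)"
    using assms g' h' by (auto simp: cart_prod_def)
  let ?n = "graph_dist (G \<box> H) (g, h) (g', h')"
  obtain i j where "i + j = ?n" "(g, g') \<in> parcs G ^^ i" "(h, h') \<in> parcs H ^^ j"
    using relpow_cart_prod[OF relpow_graph_dist[OF P v]] by blast
  then have "graph_dist G g g' + graph_dist H h h' \<le> ?n"
    using graph_dist_le_relpow assms by (metis add_mono)
  also have "\<dots> \<le> ecc (G \<box> H) (g, h)" by (rule graph_dist_le_ecc[OF P(1) v(2)])
  finally show ?thesis using g' h' by simp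
qed

lemma radius_le_rc:
  fixes G :: "'a pair_pre_digraph"
  assumes G: "pair_graph G" "connected (with_proj G)"
  shows "radius G \<le> rc G"
proof -
  interpret G: pair_graph G by fact
  have "\<exists>k. \<exists>c :: 'a set \<Rightarrow> nat. rainbow_coloring G c \<and> card (c ` edges G) = k"
    using rainbow_coloring_exists[OF G] by blast
  then have "\<exists>c :: 'a set \<Rightarrow> nat. rainbow_coloring G c \<and> card (c ` edges G) = rc G"
    unfolding rc_def by (rule LeastI_ex)
  then obtain c :: "'a set \<Rightarrow> nat"
    where c: "rainbow_coloring G c" "card (c ` edges G) = rc G" by blast
  have "pverts G \<noteq> {}" using connected_iff_path_betw G by blast
  then obtain u where u: "u \<in> pverts G" "radius G = ecc G u" by (rule radius_attained[OF G(1)])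
  obtain v where v: "v \<in> pverts G" "ecc G u = graph_dist G u v"
    by (rule ecc_attained[OF G(1) u(1)])
  \<comment> \<open>The path joins a centre to a farthest vertex, so its length is at least the
    radius.\<close>
  obtain p where p: "path_betw G u p v" "rainbow_path c p"
    using c(1) u(1) v(1) unfolding rainbow_coloring_def by blast
  let ?cs = "map (\<lambda>a. c (edge_of a)) (vwalk_arcs p)"
  have "set ?cs \<subseteq> c ` edges G"
    using p(1) by (auto simp: path_betw_def vpath_def vwalk_def edges_def)
  moreover have "finite (c ` edges G)" using G.pair_finite_arcs by (simp add: edges_def)
  ultimately have "card (set ?cs) \<le> rc G" using c(2) card_mono by metis
  moreover have "card (set ?cs) = vwalk_length p"
    using p(2) distinct_card unfolding rainbow_path_def vwalk_length_def
    by (metis length_map)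
  ultimately show ?thesis using graph_dist_le_path[OF p(1)] u v by simp
qed

section \<open>Rainbow walks\<close>

text \<open>The set is a set of permitted colours, not of the colours used.\<close>

inductive rainbow_walk :: "('a \<times> 'a) set \<Rightarrow> ('a set \<Rightarrow> 'c) \<Rightarrow> 'a \<Rightarrow> 'c set \<Rightarrow> 'a \<Rightarrow> bool"
  for E c u where
  refl: "rainbow_walk E c u C u"
| step: "rainbow_walk E c u (C - {c {v, w}}) v \<Longrightarrow> (v, w) \<in> E \<Longrightarrow> c {v, w} \<in> C \<Longrightarrow>
    rainbow_walk E c u C w"

lemma rainbow_walk_mono:
  assumes "rainbow_walk E c u C v" "C \<subseteq> D"
  shows "rainbow_walk E c u D v"
  using assms
proof (induct arbitrary: D)
  case (step C v w)
  then have "rainbow_walk E c u (D - {c {v, w}}) v" by blast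
  with step.hyps step.prems show ?case by (blast intro: rainbow_walk.step)
qed (rule rainbow_walk.refl)

text \<open>Only the palettes must be disjoint; vertices may repeat, since walks are shortened to
  paths only at the end, in \<open>rainbow_walk_path\<close>.\<close>

lemma rainbow_walk_trans:
  assumes "rainbow_walk E c v D w" "rainbow_walk E c u C v" "C \<inter> D = {}"
  shows "rainbow_walk E c u (C \<union> D) w"
  using assms
proof (induct)
  case (refl D)
  then show ?case by (blast intro: rainbow_walk_mono)
next
  case (step D x w)
  then have "rainbow_walk E c u (C \<union> (D - {c {x, w}})) x" by blast
  moreover have "C \<union> (D - {c {x, w}}) = C \<union> D - {c {x, w}}" using step by blast
  ultimately show ?case using step.hyps by (auto intro: rainbow_walk.step)
qed

text \<open>The last arc, reversed, is a walk in the single colour that was removed from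
  \<open>C\<close>; the reversed rest is appended to it.\<close>

lemma rainbow_walk_sym:
  assumes "sym E" "rainbow_walk E c u C v"
  shows "rainbow_walk E c v C u"
  using assms(2)
proof (induct)
  case (step C v w)
  have "rainbow_walk E c w {c {v, w}} v"
    using step.hyps symD[OF assms(1)] rainbow_walk.refl
    by (intro rainbow_walk.step[of E c w "{c {v, w}}" w v]) (auto simp: insert_commute)
  from rainbow_walk_trans[OF step.hyps(2) this] show ?case
    using step.hyps by (simp add: insert_absorb)
qed (rule rainbow_walk.refl)

lemma rainbow_walk_path:
  assumes "pair_graph G" "u \<in> pverts G" "rainbow_walk (parcs G) c u C v"
  shows "\<exists>p. path_betw G u p v \<and> rainbow_path c p"
proof -
  \<comment> \<open>Containment in \<open>C\<close> makes the colour of the next arc fresh;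
    shortening by \<open>path_betw_snoc\<close> only drops arcs, so both colour conditions survive
    it.\<close>
  have "\<exists>p. path_betw G u p v \<and> rainbow_path c p \<and> (\<lambda>a. c (edge_of a)) ` set (vwalk_arcs p) \<subseteq> C"
    using assms(3)
  proof (induct)
    case (refl C)
    then show ?case using path_betw_refl[OF assms(2)]
      by (intro exI[of _ "[u]"]) (auto simp: rainbow_path_def)
  next
    case (step C v w)
    let ?f = "\<lambda>a. c (edge_of a)"
    obtain p where p: "path_betw G u p v" "rainbow_path c p"
      "?f ` set (vwalk_arcs p) \<subseteq> C - {c {v, w}}" using step.hyps(2) by blast
    obtain q ys where q: "path_betw G u q w" "vwalk_arcs q @ ys = vwalk_arcs p @ [(v, w)]"
      by (rule path_betw_snoc[OF assms(1) p(1) step.hyps(3)])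
    have "distinct (map ?f (vwalk_arcs p @ [(v, w)]))" "?f ` set (vwalk_arcs p @ [(v, w)]) \<subseteq> C"
      using p step.hyps(4) by (auto simp: rainbow_path_def edge_of_def)
    then have "rainbow_path c q" "?f ` set (vwalk_arcs q) \<subseteq> C"
      unfolding q(2)[symmetric] rainbow_path_def by auto
    with q(1) show ?case by blast
  qed
  then show ?thesis by blast
qed

text \<open>\<open>f\<close> embeds the factor as a layer. Along a geodesic from \<open>r\<close>
  the i-th edge has its farther end at distance i, hence colour \<open>k + i\<close>, so no colour
  repeats.\<close>

lemma rainbow_walk_radial:
  assumes G: "pair_graph G" "connected (with_proj G)" "r \<in> pverts G" "g \<in> pverts G"
    and arcs: "\<And>a b. (a, b) \<in> parcs G \<Longrightarrow> (f a, f b) \<in> E"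
    and colour: "\<And>a b. (a, b) \<in> parcs G \<Longrightarrow>
      c {f a, f b} = k + max (graph_dist G r a) (graph_dist G r b)"
  shows "rainbow_walk E c (f r) {k<..k + ecc G r} (f g)"
proof -
  have "rainbow_walk E c (f r) {k<..k + n} (f v)"
    if "v \<in> pverts G" "graph_dist G r v = n" for n v
    using that
  proof (induct n arbitrary: v)
    case 0
    then have "r = v" using relpow_graph_dist[OF G(1-3) 0(1)] by simp
    then show ?case by (simp add: rainbow_walk.refl)
  next
    case (Suc n)
    obtain w where w: "w \<in> pverts G" "(w, v) \<in> parcs G" "graph_dist G r w = n"
      by (rule graph_dist_predecessor[OF G(1-3) Suc.prems])
    have cc: "c {f w, f v} = k + Suc n" using colour[OF w(2)] w(3) Suc.prems by simp
    have "{k<..k + Suc n} - {c {f w, f v}} = {k<..k + n}" unfolding cc by auto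
    with Suc.hyps[OF w(1,3)] show ?case
      by (intro rainbow_walk.step[OF _ arcs[OF w(2)]]) (simp_all add: cc)
  qed
  from this[OF G(4) HOL.refl] show ?thesis
    by (rule rainbow_walk_mono) (use graph_dist_le_ecc[OF G(1,4), of r] in auto)
qed

section \<open>Colouring the product\<close>

text \<open>Edges are unordered pairs, so their direction is read off the projections: the second is
  a singleton exactly for \<open>G\<close>-edges. \<open>Max\<close> selects the farther end. The
  offsets put the four palettes into consecutive intervals.\<close>

definition layer_colour ::
  "'a pair_pre_digraph \<Rightarrow> 'b pair_pre_digraph \<Rightarrow> 'a \<Rightarrow> 'b \<Rightarrow> ('a \<times> 'b) set \<Rightarrow> nat" where
  "layer_colour G H g0 h0 e =
    (if is_singleton (snd ` e)
     then (if h0 \<in> snd ` e then ecc G g0 else 0) + Max (graph_dist G g0 ` fst ` e)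
     else 2 * ecc G g0 + (if g0 \<in> fst ` e then 0 else ecc H h0)
       + Max (graph_dist H h0 ` snd ` e))"

lemma layer_colour_G_edge:
  "layer_colour G H g0 h0 {(a, h), (b, h)} =
    (if h = h0 then ecc G g0 else 0) + max (graph_dist G g0 a) (graph_dist G g0 b)"
  by (auto simp: layer_colour_def is_singleton_def)

lemma layer_colour_H_edge:
  assumes "a \<noteq> b"
  shows "layer_colour G H g0 h0 {(g, a), (g, b)} =
    2 * ecc G g0 + (if g = g0 then 0 else ecc H h0)
      + max (graph_dist H h0 a) (graph_dist H h0 b)"
  using assms by (auto simp: layer_colour_def is_singleton_def doubleton_eq_iff)

text \<open>Only a loop could have both ends at the root. Hence colours start at 1, and no extra
  colour 0 spoils the count in \<open>layer_colour_range\<close>.\<close>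

lemma graph_dist_arc_pos:
  assumes "pair_graph G" "connected (with_proj G)" "r \<in> pverts G" "(a, b) \<in> parcs G"
  shows "0 < max (graph_dist G r a) (graph_dist G r b)"
proof (rule ccontr)
  interpret G: pair_graph G by fact
  assume "\<not> ?thesis"
  then have "graph_dist G r a = 0" "graph_dist G r b = 0" by auto
  then have "r = a" "r = b"
    using relpow_graph_dist[OF assms(1-3), of a] relpow_graph_dist[OF assms(1-3), of b]
      G.in_arcsD1[OF assms(4)] G.in_arcsD2[OF assms(4)] by auto
  then show False using G.pair_no_loops[OF assms(4)] by simp
qed

lemma layer_colour_range:
  assumes "pair_graph G" "pair_graph H" "connected (with_proj G)" "connected (with_proj H)"
    and "g0 \<in> pverts G" "h0 \<in> pverts H"
  shows "layer_colour G H g0 h0 ` edges (G \<box> H) \<subseteq> {0<..2 * (ecc G g0 + ecc H h0)}"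
proof -
  interpret G: pair_graph G by fact
  interpret H: pair_graph H by fact
  have 1: "0 < max (graph_dist G g0 a) (graph_dist G g0 b)"
    "max (graph_dist G g0 a) (graph_dist G g0 b) \<le> ecc G g0" if "(a, b) \<in> parcs G" for a b
    using graph_dist_arc_pos[OF assms(1,3,5) that] graph_dist_le_ecc[OF assms(1)]
      G.in_arcsD1[OF that] G.in_arcsD2[OF that] by auto
  have 2: "0 < max (graph_dist H h0 a) (graph_dist H h0 b)"
    "max (graph_dist H h0 a) (graph_dist H h0 b) \<le> ecc H h0" "a \<noteq> b"
    if "(a, b) \<in> parcs H" for a b
    using graph_dist_arc_pos[OF assms(2,4,6) that] graph_dist_le_ecc[OF assms(2)]
      H.pair_no_loops[OF that] H.in_arcsD1[OF that] H.in_arcsD2[OF that] by auto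
  have "layer_colour G H g0 h0 (edge_of e) \<in> {0<..2 * (ecc G g0 + ecc H h0)}"
    if "e \<in> parcs (G \<box> H)" for e
  proof -
    from that consider
        g a b where "e = ((g, a), (g, b))" "(a, b) \<in> parcs H"
      | h a b where "e = ((a, h), (b, h))" "(a, b) \<in> parcs G"
      by (auto simp: cart_prod_def)
    then show ?thesis
    proof cases
      case 1
      with 2[OF 1(2)] show ?thesis
        by (simp add: edge_of_def layer_colour_H_edge
              del: max_less_iff_conj less_max_iff_disj max.bounded_iff)
    next
      case 2
      with 1[OF 2(2)] show ?thesis
        by (simp add: edge_of_def layer_colour_G_edge
              del: max_less_iff_conj less_max_iff_disj max.bounded_iff)
    qed
  qed
  then show ?thesis by (auto simp: edges_def)
qed

lemma nontrivial_other_vertex: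
  assumes "pair_graph G" "\<not> trivial_graph G" "v \<in> pverts G"
  obtains w where "w \<in> pverts G" "w \<noteq> v"
proof -
  have "pverts G \<noteq> {v}" using assms(2) by (auto simp: trivial_graph_def)
  then show ?thesis using that assms(3) by blast
qed

lemma rainbow_coloring_layer_colour:
  assumes "pair_graph G" "pair_graph H" "\<not> trivial_graph G" "\<not> trivial_graph H"
    and "connected (with_proj G)" "connected (with_proj H)"
    and g0: "g0 \<in> pverts G" and h0: "h0 \<in> pverts H"
  shows "rainbow_coloring (G \<box> H) (layer_colour G H g0 h0)"
proof -
  interpret P: pair_graph "G \<box> H" using assms by (intro pair_graph_cart_prod)
  interpret H: pair_graph H by fact
  let ?R = "ecc G g0" and ?S = "ecc H h0"
  let ?W = "rainbow_walk (parcs (G \<box> H)) (layer_colour G H g0 h0)"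
  define A where "A = {0<..?R}"
  define A' where "A' = {?R<..?R + ?R}"
  define B where "B = {2 * ?R<..2 * ?R + ?S}"
  define B' where "B' = {2 * ?R + ?S<..2 * ?R + ?S + ?S}"
  have disj: "A \<inter> A' = {}" "A \<inter> B = {}" "A \<inter> B' = {}" "A' \<inter> B = {}" "A' \<inter> B' = {}" "B \<inter> B' = {}"
    by (auto simp: A_def A'_def B_def B'_def)
  note disj = disj disj[THEN trans[OF Int_commute]]
  have W_sym: "?W v C u" if "?W u C v" for u v C
    using P.pair_sym_arcs by (intro rainbow_walk_sym[OF _ that]) (simp add: symmetric_def)
  have chain: "?W u (A \<union> A' \<union> B \<union> B') v"
    if "?W u C1 x" "?W x C2 y" "?W y C3 z" "?W z C4 v"
      "C1 \<union> C2 \<union> C3 \<union> C4 = A \<union> A' \<union> B \<union> B'"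
      "C1 \<inter> C2 = {}" "(C1 \<union> C2) \<inter> C3 = {}" "(C1 \<union> C2 \<union> C3) \<inter> C4 = {}"
    for u x y z v C1 C2 C3 C4
    using rainbow_walk_trans[OF that(4) rainbow_walk_trans[OF that(3)
      rainbow_walk_trans[OF that(2,1,6)] that(7)] that(8)] that(5) by simp
  have layer_G: "?W (g0, h) {k<..k + ?R} (g, h)"
    if "g \<in> pverts G" "h \<in> pverts H" "k = (if h = h0 then ?R else 0)" for g h k
    using that by (intro rainbow_walk_radial[OF assms(1,5) g0, where f = "\<lambda>a. (a, h)"])
      (auto simp: layer_colour_G_edge cart_prod_def)
  have layer_H: "?W (g, h0) {k<..k + ?S} (g, h)"
    if "g \<in> pverts G" "h \<in> pverts H" "k = 2 * ?R + (if g = g0 then 0 else ?S)" for g h k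
  proof (rule rainbow_walk_radial[OF assms(2,6) h0 that(2), where f = "\<lambda>a. (g, a)"])
    fix a b assume ab: "(a, b) \<in> parcs H"
    then show "((g, a), (g, b)) \<in> parcs (G \<box> H)" using that(1) by (simp add: cart_prod_def)
    have "a \<noteq> b" using H.pair_no_loops[OF ab] by simp
    then show "layer_colour G H g0 h0 {(g, a), (g, b)} =
        k + max (graph_dist H h0 a) (graph_dist H h0 b)"
      unfolding that(3) by (rule layer_colour_H_edge)
  qed
  \<comment> \<open>The alternative \<open>g = g0\<close> is the walk without steps, valid in every
    layer; \<open>WB'\<close> treats \<open>h = h0\<close> likewise.\<close>
  have WA: "?W (g0, h) A (g, h)" if "h \<noteq> h0 \<or> g = g0" "g \<in> pverts G" "h \<in> pverts H" for g h
  proof (cases "g = g0")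
    case False
    then show ?thesis using layer_G[OF that(2,3), of 0] that(1) by (simp add: A_def)
  qed (simp add: rainbow_walk.refl)
  have WA': "?W (g0, h0) A' (g, h0)" if "g \<in> pverts G" for g
    using layer_G[OF that h0, of ?R] by (simp add: A'_def)
  have WB: "?W (g0, h0) B (g0, h)" if "h \<in> pverts H" for h
    using layer_H[OF g0 that, of "2 * ?R"] by (simp add: B_def)
  have WB': "?W (g, h0) B' (g, h)" if "g \<noteq> g0 \<or> h = h0" "g \<in> pverts G" "h \<in> pverts H" for g h
  proof (cases "h = h0")
    case False
    then show ?thesis using layer_H[OF that(2,3), of "2 * ?R + ?S"] that(1) by (simp add: B'_def)
  qed (simp add: rainbow_walk.refl)
  obtain x where x: "x \<in> pverts G" "x \<noteq> g0" by (rule nontrivial_other_vertex[OF assms(1,3) g0])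
  obtain y where y: "y \<in> pverts H" "y \<noteq> h0" by (rule nontrivial_other_vertex[OF assms(2,4) h0])
  have generic: "?W (g, h) (A \<union> A' \<union> B \<union> B') (g', h')"
    if "g = g0 \<or> h \<noteq> h0" "g' \<noteq> g0 \<or> h' = h0"
      "g \<in> pverts G" "h \<in> pverts H" "g' \<in> pverts G" "h' \<in> pverts H" for g h g' h'
    by (rule chain[OF W_sym[OF WA] W_sym[OF WB] WA' WB'])
      (simp add: disj Int_Un_distrib2 Un_ac | use that in blast)+
  have "?W (g, h) (A \<union> A' \<union> B \<union> B') (g', h')"
    if v: "g \<in> pverts G" "h \<in> pverts H" "g' \<in> pverts G" "h' \<in> pverts H" for g h g' h'
  proof -
    \<comment> \<open>A generic walk cannot start at a non-root vertex of the layer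
      \<open>h0\<close>, nor end at a non-root vertex of the layer \<open>g0\<close>. No vertex is
      both, so both directions fail only if the two vertices are of the same kind: the last two
      cases.\<close>
    consider "g = g0 \<or> h \<noteq> h0" "g' \<noteq> g0 \<or> h' = h0"
      | "g' = g0 \<or> h' \<noteq> h0" "g \<noteq> g0 \<or> h = h0"
      | "g \<noteq> g0" "g' \<noteq> g0" "h = h0" "h' = h0"
      | "g = g0" "g' = g0" "h \<noteq> h0" "h' \<noteq> h0" by blast
    then show ?thesis
    proof cases
      case 1
      then show ?thesis using v by (intro generic)
    next
      case 2
      then show ?thesis using v by (intro W_sym[OF generic])
    next
      case 3
      \<comment> \<open>Route: \<open>(g, h0)\<close>, \<open>(g0, h0)\<close>,
        \<open>(g0, y)\<close>, \<open>(g', y)\<close>, \<open>(g', h0)\<close>.\<close>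
      show ?thesis unfolding 3(3,4)
        by (rule chain[OF W_sym[OF WA'] WB WA W_sym[OF WB']])
      (simp add: disj Int_Un_distrib2 Un_ac | use v y 3 in blast)+
    next
      case 4
      \<comment> \<open>Route: \<open>(g0, h)\<close>, \<open>(g0, h0)\<close>,
        \<open>(x, h0)\<close>, \<open>(x, h')\<close>, \<open>(g0, h')\<close>.\<close>
      show ?thesis unfolding 4(1,2)
        by (rule chain[OF W_sym[OF WB] WA' WB' W_sym[OF WA]])
      (simp add: disj Int_Un_distrib2 Un_ac | use v x 4 in blast)+
    qed
  qed
  then have "\<exists>p. path_betw (G \<box> H) u p v \<and> rainbow_path (layer_colour G H g0 h0) p"
    if "u \<in> pverts (G \<box> H)" "v \<in> pverts (G \<box> H)" for u v
    using that by (intro rainbow_walk_path[OF P.pair_graph that(1)]) (auto simp: cart_prod_def)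
  then show ?thesis by (simp add: rainbow_coloring_def)
qed

lemma rc_le_card:
  assumes "rainbow_coloring G (c :: 'a set \<Rightarrow> nat)"
  shows "rc G \<le> card (c ` edges G)"
  unfolding rc_def using assms by (intro Least_le) blast

theorem theorem2:
  fixes G' :: "'a pair_pre_digraph" and H' :: "'b pair_pre_digraph"
  assumes "pair_graph G'" and "pair_graph H'"
    and "\<not> trivial_graph G'" and "\<not> trivial_graph H'"
    and "connected (with_proj G')" and "connected (with_proj H')"
  shows "radius (G' \<box> H') \<le> rc (G' \<box> H') \<and> rc (G' \<box> H') \<le> 2 * radius (G' \<box> H')"
proof
  have P: "pair_graph (G' \<box> H')" "connected (with_proj (G' \<box> H'))"
    using assms by (auto intro: pair_graph_cart_prod connected_cart_prod)
  then show "radius (G' \<box> H') \<le> rc (G' \<box> H')" by (rule radius_le_rc)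
  have "pverts (G' \<box> H') \<noteq> {}" using connected_iff_path_betw P by blast
  then obtain u where u: "u \<in> pverts (G' \<box> H')" "radius (G' \<box> H') = ecc (G' \<box> H') u"
    by (rule radius_attained[OF P(1)])
  obtain g0 h0 where g0: "u = (g0, h0)" "g0 \<in> pverts G'" "h0 \<in> pverts H'"
    using u(1) by (auto simp: cart_prod_def)
  let ?c = "layer_colour G' H' g0 h0"
  have "rc (G' \<box> H') \<le> card (?c ` edges (G' \<box> H'))"
    using assms g0 by (intro rc_le_card rainbow_coloring_layer_colour)
  also have "\<dots> \<le> card {0<..2 * (ecc G' g0 + ecc H' h0)}"
    using assms g0 by (intro card_mono layer_colour_range) simp_all
  also have "\<dots> \<le> 2 * radius (G' \<box> H')"
    using ecc_cart_prod_ge[OF assms(1,2,5,6) g0(2,3)] u(2) g0(1) by simp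
  finally show "rc (G' \<box> H') \<le> 2 * radius (G' \<box> H')" .
qed

end
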